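(* Fix an integer $t\ge 1$, let $\beta^\star\in(1/2,1]$ and $T^\star>0$. For each $K$ put $\delta^\star=\delta^\star(K)=\sqrt{2(1/T^\star)\ln K}$, $\varepsilon^\star=\varepsilon^\star(K)=K^{-\beta^\star}$, let $\mathbf{P}^\star=\mathbf{P}_{\varepsilon^\star,\delta^\star}$ with expectation $\mathbf{E}^\star$, and let $E^\star_t$ be the likelihood ratio $$E^\star_t=\prod_{i=1}^K\left\{(1-\varepsilon^\star)+\varepsilon^\star\frac{p_{\delta^\star}(X_{i,1},\dots,X_{i,t})}{p_0(X_{i,1},\dots,X_{i,t})}\right\}.$$ Let $t^\star=T^\star\rho(\beta^\star)$. Then, as $K\to\infty$, $$\mathbf{E}^\star[\ln E^\star_t]\to\begin{cases}0&\text{if } t<t^\star,\\ \infty&\text{if } t>t^\star.\end{cases}$$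
   Context: Model: for $K\in\mathbf{N}$, $\varepsilon\in[0,1]$, $\delta>0$, $\mathbf{P}_{\varepsilon,\delta}$ is the law of an array $(X_{i,s})_{1\le i\le K,\,s\ge1}$ generated as follows: $A_1,\dots,A_K$ are i.i.d. Bernoulli$(\varepsilon)$ (latent), and conditionally on $(A_i)$ the $X_{i,s}$ are independent with $X_{i,s}\sim\mathrm{Normal}(\delta A_i,1)$. $p_\delta(x_1,\dots,x_t)=\prod_{s\le t}\frac{1}{\sqrt{2\pi}}e^{-(x_s-\delta)^2/2}$ is the joint density of $t$ i.i.d. Normal$(\delta,1)$ variables. Detection boundary: $\rho(\beta)=\beta-\frac12$ for $\beta\in(1/2,3/4)$ and $\rho(\beta)=(1-\sqrt{1-\beta})^2$ for $\beta\in[3/4,1]$. *)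

theory Defs
  imports "HOL-Probability.Probability"
begin

text \<open>
  An array \<open>(X\<^sub>i\<^sub>,\<^sub>s)\<close>, \<open>1 \<le> i \<le> K\<close>, \<open>s \<ge> 1\<close>, is a function on pairs \<open>(i, s)\<close>, and the random
  variables \<open>X\<^sub>i\<^sub>,\<^sub>s\<close> are the coordinate maps on the product space \<open>array_space K\<close>.
\<close>

definition array_index :: "nat \<Rightarrow> (nat \<times> nat) set" where
  "array_index K = {1..K} \<times> {1..}"

definition array_space :: "nat \<Rightarrow> (nat \<times> nat \<Rightarrow> real) measure" where
  "array_space K = PiM (array_index K) (\<lambda>_. borel)"

definition normal_measure :: "real \<Rightarrow> real measure" where
  "normal_measure \<mu> = density lborel (\<lambda>x. ennreal (normal_density \<mu> 1 x))"

definition latent_law :: "nat \<Rightarrow> real \<Rightarrow> (nat \<Rightarrow> bool) pmf" where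
  "latent_law K \<epsilon> = Pi_pmf {1..K} False (\<lambda>_. bernoulli_pmf \<epsilon>)"

definition conditional_law :: "nat \<Rightarrow> real \<Rightarrow> (nat \<Rightarrow> bool) \<Rightarrow> (nat \<times> nat \<Rightarrow> real) measure" where
  "conditional_law K \<delta> A = PiM (array_index K) (\<lambda>(i, s). normal_measure (\<delta> * of_bool (A i)))"

text \<open>
  The Giry bind first draws the latent \<open>A\<close> and then, given \<open>A\<close>, the array; it yields the law of
  the array alone, with \<open>A\<close> integrated out.
\<close>

definition array_law :: "nat \<Rightarrow> real \<Rightarrow> real \<Rightarrow> (nat \<times> nat \<Rightarrow> real) measure" where
  "array_law K \<epsilon> \<delta> = measure_pmf (latent_law K \<epsilon>) \<bind> conditional_law K \<delta>"

definition joint_density :: "nat \<Rightarrow> real \<Rightarrow> (nat \<Rightarrow> real) \<Rightarrow> real" where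
  "joint_density t \<delta> x = (\<Prod>s=1..t. normal_density \<delta> 1 (x s))"

definition likelihood_ratio :: "nat \<Rightarrow> real \<Rightarrow> real \<Rightarrow> nat \<Rightarrow> (nat \<times> nat \<Rightarrow> real) \<Rightarrow> real" where
  "likelihood_ratio K \<epsilon> \<delta> t X =
     (\<Prod>i=1..K. (1 - \<epsilon>) + \<epsilon> * (joint_density t \<delta> (\<lambda>s. X (i, s)) / joint_density t 0 (\<lambda>s. X (i, s))))"

definition detection_boundary :: "real \<Rightarrow> real" where
  "detection_boundary \<beta> = (if \<beta> < 3/4 then \<beta> - 1/2 else (1 - sqrt (1 - \<beta>))\<^sup>2)"

text \<open>
  The remaining facts show that \<open>array_law\<close> is a probability measure on \<open>array_space\<close> and that the
  logarithm of the likelihood ratio is integrable, so that its Bochner integral is the expectation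
  and not the default value \<open>0\<close>.
\<close>

lemma prob_space_normal_measure: "prob_space (normal_measure \<mu>)"
  unfolding normal_measure_def by (rule prob_space_normal_density) simp

lemma sets_normal_measure [simp, measurable_cong]: "sets (normal_measure \<mu>) = sets borel"
  by (simp add: normal_measure_def)

lemma sets_conditional_law: "sets (conditional_law K \<delta> A) = sets (array_space K)"
  unfolding conditional_law_def array_space_def
  by (rule sets_PiM_cong) auto

lemma prob_space_conditional_law: "prob_space (conditional_law K \<delta> A)"
  unfolding conditional_law_def
  by (rule prob_space_PiM) (auto simp: prob_space_normal_measure)

lemma measurable_conditional_law:
  "conditional_law K \<delta> \<in> measurable (measure_pmf p) (subprob_algebra (array_space K))"
proof -
  have "conditional_law K \<delta> A \<in> space (subprob_algebra (array_space K))" for A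
    unfolding space_subprob_algebra
    using prob_space_conditional_law[of K \<delta> A]
    by (simp add: prob_space_imp_subprob_space sets_conditional_law)
  then show ?thesis by (simp add: measurable_pmf_measure1)
qed

lemma sets_array_law: "sets (array_law K \<epsilon> \<delta>) = sets (array_space K)"
  unfolding array_law_def by (rule sets_bind) (auto simp: sets_conditional_law)

lemma prob_space_array_law: "prob_space (array_law K \<epsilon> \<delta>)"
  unfolding array_law_def
  by (rule prob_space.prob_space_bind[OF measure_pmf.prob_space_axioms _ measurable_conditional_law])
     (simp add: prob_space_conditional_law)

lemma integrable_coordinate:
  assumes "(i, s) \<in> array_index K"
  shows "integrable (array_law K \<epsilon> \<delta>) (\<lambda>X. X (i, s))"
proof -
  have m [measurable]: "(\<lambda>X. X (i, s)) \<in> borel_measurable (array_space K)"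
    unfolding array_space_def by (rule measurable_component_singleton) (fact assms)
  define c where "c b = (\<integral>\<^sup>+x. ennreal (norm x) \<partial>normal_measure (\<delta> * of_bool b))" for b
  have c_fin: "c b < \<infinity>" for b
  proof -
    have "integrable (normal_measure \<mu>) (\<lambda>x. x)" for \<mu>
      unfolding normal_measure_def
      by (subst integrable_density) (auto intro: integrable_normal_moment_nz_1)
    then show ?thesis unfolding c_def by (auto simp: integrable_iff_bounded)
  qed
  have inner: "(\<integral>\<^sup>+X. ennreal (norm (X (i, s))) \<partial>conditional_law K \<delta> A) = c (A i)" for A
  proof -
    let ?N = "\<lambda>(i, s). normal_measure (\<delta> * of_bool (A i))"
    have d: "distr (conditional_law K \<delta> A) (?N (i, s)) (\<lambda>X. X (i, s)) = ?N (i, s)"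
      unfolding conditional_law_def
      by (rule distr_PiM_component) (use assms in \<open>auto simp: prob_space_normal_measure\<close>)
    have m': "(\<lambda>X. X (i, s)) \<in> measurable (conditional_law K \<delta> A) (?N (i, s))"
      unfolding conditional_law_def by (rule measurable_component_singleton) (fact assms)
    have "c (A i) = (\<integral>\<^sup>+x. ennreal (norm x) \<partial>distr (conditional_law K \<delta> A) (?N (i, s)) (\<lambda>X. X (i, s)))"
      unfolding d by (simp add: c_def)
    also have "\<dots> = (\<integral>\<^sup>+X. ennreal (norm (X (i, s))) \<partial>conditional_law K \<delta> A)"
      by (rule nn_integral_distr[OF m']) (simp cong: measurable_cong_sets)
    finally show ?thesis by simp
  qed
  have "(\<integral>\<^sup>+X. ennreal (norm (X (i, s))) \<partial>array_law K \<epsilon> \<delta>)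
        = (\<integral>\<^sup>+A. c (A i) \<partial>measure_pmf (latent_law K \<epsilon>))"
    unfolding array_law_def
    by (subst nn_integral_bind[OF _ measurable_conditional_law]) (auto simp: inner[unfolded real_norm_def])
  also have "\<dots> \<le> (\<integral>\<^sup>+A. max (c False) (c True) \<partial>measure_pmf (latent_law K \<epsilon>))"
  proof (rule nn_integral_mono)
    show "c (A i) \<le> max (c False) (c True)" for A by (cases "A i") auto
  qed
  also have "\<dots> < \<infinity>" using c_fin by (simp add: measure_pmf.emeasure_space_1)
  finally show ?thesis
    by (simp add: integrable_iff_bounded m cong: measurable_cong_sets[OF sets_array_law refl])
qed

lemma joint_density_pos: "0 < joint_density t \<delta> x"
  unfolding joint_density_def by (intro prod_pos) (auto intro: normal_density_pos)

lemma ln_density_ratio: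
  "ln (joint_density t \<delta> x / joint_density t 0 x) = (\<Sum>s=1..t. \<delta> * x s - \<delta>\<^sup>2 / 2)"
proof -
  have "normal_density \<delta> 1 y / normal_density 0 1 y = exp (\<delta> * y - \<delta>\<^sup>2 / 2)" for y
    unfolding normal_density_def
    by (simp add: exp_diff[symmetric] power2_eq_square field_simps)
  then have "joint_density t \<delta> x / joint_density t 0 x = exp (\<Sum>s=1..t. \<delta> * x s - \<delta>\<^sup>2 / 2)"
    unfolding joint_density_def by (simp add: prod_dividef[symmetric] exp_sum)
  then show ?thesis by simp
qed

lemma abs_ln_mixture_le:
  fixes r \<epsilon> :: real
  assumes "0 < r" "0 \<le> \<epsilon>" "\<epsilon> \<le> 1"
  shows "0 < (1 - \<epsilon>) + \<epsilon> * r" and "\<bar>ln ((1 - \<epsilon>) + \<epsilon> * r)\<bar> \<le> \<bar>ln r\<bar>"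
proof -
  have lower: "min 1 r \<le> (1 - \<epsilon>) + \<epsilon> * r"
    using convex_bound_le[of "-1" "- min 1 r" "- r" "1 - \<epsilon>" \<epsilon>] assms by auto
  have upper: "(1 - \<epsilon>) + \<epsilon> * r \<le> max 1 r"
    using convex_bound_le[of 1 "max 1 r" r "1 - \<epsilon>" \<epsilon>] assms by auto
  show pos: "0 < (1 - \<epsilon>) + \<epsilon> * r" using lower assms by linarith
  have "ln (min 1 r) \<le> ln ((1 - \<epsilon>) + \<epsilon> * r)" "ln ((1 - \<epsilon>) + \<epsilon> * r) \<le> ln (max 1 r)"
    using lower upper pos assms by (auto simp del: min_le_iff_disj le_max_iff_disj)
  then show "\<bar>ln ((1 - \<epsilon>) + \<epsilon> * r)\<bar> \<le> \<bar>ln r\<bar>"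
    using assms by (cases "r \<le> 1") (auto simp: min_absorb1 min_absorb2 max_absorb1 max_absorb2)
qed

lemma integrable_ln_likelihood_ratio:
  assumes "0 \<le> \<epsilon>" "\<epsilon> \<le> 1"
  shows "integrable (array_law K \<epsilon>' \<delta>') (\<lambda>X. ln (likelihood_ratio K \<epsilon> \<delta> t X))"
proof -
  interpret prob_space "array_law K \<epsilon>' \<delta>'" by (rule prob_space_array_law)
  let ?r = "\<lambda>i X. joint_density t \<delta> (\<lambda>s. X (i, s)) / joint_density t 0 (\<lambda>s. X (i, s))"
  have r_pos: "0 < ?r i X" for i and X :: "nat \<times> nat \<Rightarrow> real"
    by (simp add: joint_density_pos)
  have eq: "ln (likelihood_ratio K \<epsilon> \<delta> t X) = (\<Sum>i=1..K. ln ((1 - \<epsilon>) + \<epsilon> * ?r i X))" for X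
    unfolding likelihood_ratio_def
    by (rule ln_prod) (rule finite_atLeastAtMost, rule less_imp_neq[OF abs_ln_mixture_le(1)[OF r_pos assms], symmetric])
  show ?thesis unfolding eq
  proof (rule Bochner_Integration.integrable_sum)
    fix i assume i: "i \<in> {1..K}"
    have coord: "integrable (array_law K \<epsilon>' \<delta>') (\<lambda>X. X (i, s))" if "s \<in> {1..t}" for s
      by (rule integrable_coordinate) (use i that in \<open>auto simp: array_index_def\<close>)
    have ln_r: "integrable (array_law K \<epsilon>' \<delta>') (\<lambda>X. ln (?r i X))"
      unfolding ln_density_ratio
      by (intro Bochner_Integration.integrable_sum Bochner_Integration.integrable_diff
          integrable_mult_right coord) auto
    then have [measurable]: "(\<lambda>X. ln (?r i X)) \<in> borel_measurable (array_law K \<epsilon>' \<delta>')"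
      by (rule borel_measurable_integrable)
    have r_eq: "?r i X = exp (ln (?r i X))" for X using r_pos by simp
    show "integrable (array_law K \<epsilon>' \<delta>') (\<lambda>X. ln ((1 - \<epsilon>) + \<epsilon> * ?r i X))"
    proof (rule Bochner_Integration.integrable_bound[OF ln_r])
      have "(\<lambda>X. ln ((1 - \<epsilon>) + \<epsilon> * exp (ln (?r i X)))) \<in> borel_measurable (array_law K \<epsilon>' \<delta>')"
        by measurable
      then show "(\<lambda>X. ln ((1 - \<epsilon>) + \<epsilon> * ?r i X)) \<in> borel_measurable (array_law K \<epsilon>' \<delta>')"
        unfolding r_eq[symmetric] .
    qed (use abs_ln_mixture_le(2)[OF r_pos assms] in auto)
  qed
qed

end

theory Submission
  imports Defs "HOL-Real_Asymp.Real_Asymp"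
begin

text \<open>
  The normalized row sums \<open>Z\<^sub>i = (X\<^sub>i\<^sub>1 + \<dots> + X\<^sub>i\<^sub>t) / \<surd>t\<close> are sufficient, so with \<open>\<theta> = \<delta> \<surd>t\<close> and
  \<open>f z = (1 - \<epsilon>) + \<epsilon> exp (\<theta> z - \<theta>\<^sup>2 / 2)\<close> the expectation is \<open>K\<close> times the Kullback-Leibler divergence
  \<open>\<integral> \<phi> (f ln f - f + 1)\<close>, whose integrand is nonnegative. Put \<open>r = t / T = u\<^sup>2\<close>.

  Below the boundary, \<open>f ln f - f + 1 \<le> C \<bar>f - 1\<bar>\<^sup>p\<close> for \<open>1 < p \<le> 2\<close>, and the \<open>p\<close>-th moment of the
  density ratio gives the bound \<open>K\<close> to the power \<open>1 - p \<beta> + p (p - 1) r\<close>; some \<open>p\<close> makes this exponent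
  negative exactly when \<open>r < \<rho>(\<beta>)\<close>.

  Above the boundary, the integral over a unit interval starting at \<open>z = y \<surd>(2 ln K)\<close> already diverges
  for a suitable \<open>y\<close>. Only for \<open>\<beta> = 1\<close> is there no polynomial growth; there the interval starts at
  \<open>z = \<theta>\<close>, and the factor \<open>ln f\<close> supplies growth of order \<open>ln K\<close>.
\<close>

subsection \<open>The law of a normalized row sum\<close>

text \<open>Restricting a product measure to finitely many coordinates gives the product of the
  marginals, which characterizes independence. The factors are traded for \<open>borel\<close>,
  which has the same measurable sets, to fit \<open>sum_indep_normal\<close>.\<close>

lemma indep_vars_conditional_law:
  assumes "J \<subseteq> array_index K" "finite J" "J \<noteq> {}"
  shows "prob_space.indep_vars (conditional_law K \<delta> A) (\<lambda>_. borel) (\<lambda>p X. X p) J"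
proof -
  let ?N = "\<lambda>(i, s). normal_measure (\<delta> * of_bool (A i))"
  interpret prob_space "conditional_law K \<delta> A" by (rule prob_space_conditional_law)
  have N: "prob_space (?N p)" for p by (auto simp: prob_space_normal_measure split: prod.split)
  interpret P: product_prob_space ?N "array_index K"
    by (rule product_prob_spaceI) (rule N)
  have sets_N: "sets (?N p) = sets borel" for p by (auto split: prod.split)
  have m: "random_variable borel (\<lambda>X. X p)" if "p \<in> J" for p
  proof -
    have "(\<lambda>X. X p) \<in> measurable (PiM (array_index K) ?N) (?N p)"
      by (rule measurable_component_singleton) (use that assms(1) in auto)
    then show ?thesis
      unfolding conditional_law_def measurable_cong_sets[OF refl sets_N] .
  qed
  have d: "distr (conditional_law K \<delta> A) borel (\<lambda>X. X p) = ?N p" if "p \<in> J" for p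
  proof -
    have "distr (conditional_law K \<delta> A) borel (\<lambda>X. X p) = distr (conditional_law K \<delta> A) (?N p) (\<lambda>X. X p)"
      by (rule distr_cong) (auto simp: sets_N)
    also have "\<dots> = ?N p" unfolding conditional_law_def
      by (rule distr_PiM_component) (use N that assms(1) in auto)
    finally show ?thesis .
  qed
  have "distr (conditional_law K \<delta> A) (\<Pi>\<^sub>M p\<in>J. borel) (\<lambda>X. \<lambda>p\<in>J. X p)
      = distr (conditional_law K \<delta> A) (PiM J ?N) (\<lambda>X. restrict X J)"
    by (rule distr_cong) (auto simp: sets_N intro!: sets_PiM_cong)
  also have "\<dots> = PiM J ?N"
    unfolding conditional_law_def by (rule P.distr_PiM_restrict_finite) (use assms in auto)
  also have "\<dots> = (\<Pi>\<^sub>M p\<in>J. distr (conditional_law K \<delta> A) borel (\<lambda>X. X p))"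
    by (rule PiM_cong) (auto simp: d)
  finally show ?thesis
    using assms m by (subst indep_vars_iff_distr_eq_PiM') auto
qed

text \<open>Given \<open>A\<close>, row \<open>i\<close> consists of independent unit-variance
  normals with a common mean, so its sum has variance \<open>t\<close>; dividing by
  \<open>sqrt t\<close> restores unit variance.\<close>

lemma distributed_normalized_sum_conditional_law:
  assumes "i \<in> {1..K}" "t \<ge> 1"
  shows "distributed (conditional_law K \<delta> A) lborel (\<lambda>X. (\<Sum>s=1..t. X (i, s)) / sqrt t)
    (normal_density (\<delta> * sqrt t * of_bool (A i)) 1)"
proof -
  interpret prob_space "conditional_law K \<delta> A" by (rule prob_space_conditional_law)
  let ?N = "\<lambda>(i, s). normal_measure (\<delta> * of_bool (A i))"
  let ?J = "{i} \<times> {1..t}"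
  have J: "?J \<subseteq> array_index K" "finite ?J" "?J \<noteq> {}"
    using assms by (auto simp: array_index_def)
  have ind: "indep_vars (\<lambda>_. borel) (\<lambda>p X. X p) ?J" by (rule indep_vars_conditional_law[OF J])
  have n: "distributed (conditional_law K \<delta> A) lborel (\<lambda>X. X p) (normal_density (\<delta> * of_bool (A i)) 1)"
    if "p \<in> ?J" for p
  proof -
    have p: "p \<in> array_index K" and fst: "fst p = i" using that J by auto
    have "distr (conditional_law K \<delta> A) lborel (\<lambda>X. X p) = distr (conditional_law K \<delta> A) (?N p) (\<lambda>X. X p)"
      by (rule distr_cong) (auto split: prod.split)
    also have "\<dots> = ?N p" unfolding conditional_law_def
      by (rule distr_PiM_component) (use p in \<open>auto simp: prob_space_normal_measure split: prod.split\<close>)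
    also have "\<dots> = density lborel (normal_density (\<delta> * of_bool (A i)) 1)"
      using fst by (auto simp: normal_measure_def split: prod.split)
    finally show ?thesis
      using ind that unfolding distributed_def indep_vars_def by auto
  qed
  have "distributed (conditional_law K \<delta> A) lborel (\<lambda>X. \<Sum>p\<in>?J. X p)
     (normal_density (\<Sum>p\<in>?J. \<delta> * of_bool (A i)) (sqrt (\<Sum>p\<in>?J. 1\<^sup>2)))"
    by (rule sum_indep_normal[OF J(2,3) ind]) (use n in auto)
  moreover have Pair_i: "?J = Pair i ` {1..t}" by auto
  then have "(\<Sum>p\<in>?J. X p) = (\<Sum>s=1..t. X (i, s))" for X :: "nat \<times> nat \<Rightarrow> real"
    using sum.reindex[of "Pair i" "{1..t}" X] by (simp add: inj_on_def Pair_i)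
  ultimately have "distributed (conditional_law K \<delta> A) lborel (\<lambda>X. \<Sum>s=1..t. X (i, s))
     (normal_density (t * (\<delta> * of_bool (A i))) (sqrt t))"
    by simp
  from normal_density_affine[OF this, of "1 / sqrt t" 0] assms(2)
  have "distributed (conditional_law K \<delta> A) lborel (\<lambda>X. 0 + 1 / sqrt t * (\<Sum>s=1..t. X (i, s)))
      (normal_density (0 + 1 / sqrt t * (t * (\<delta> * of_bool (A i)))) (\<bar>1 / sqrt t\<bar> * sqrt t))"
    by simp
  moreover have "0 + 1 / sqrt t * (t * (\<delta> * of_bool (A i))) = \<delta> * sqrt t * of_bool (A i)"
    using assms(2) by (simp add: field_simps)
  moreover have "\<bar>1 / sqrt t\<bar> * sqrt t = 1" using assms(2) by simp
  moreover have "0 + 1 / sqrt t * x = x / sqrt t" for x by simp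
  ultimately show ?thesis by (simp only:)
qed

text \<open>The density of the mixture of N(0,1) and N(\<theta>,1), with weights
  \<open>1 - \<epsilon>\<close> and \<open>\<epsilon>\<close>, relative to N(0,1).\<close>

definition mixture_ratio :: "real \<Rightarrow> real \<Rightarrow> real \<Rightarrow> real" where
  "mixture_ratio \<epsilon> \<theta> z = (1 - \<epsilon>) + \<epsilon> * exp (\<theta> * z - \<theta>\<^sup>2 / 2)"

lemma borel_measurable_mixture_ratio [measurable]: "mixture_ratio \<epsilon> \<theta> \<in> borel_measurable borel"
  unfolding mixture_ratio_def by measurable

lemma mixture_ratio_pos:
  assumes "0 \<le> \<epsilon>" "\<epsilon> \<le> 1"
  shows "0 < mixture_ratio \<epsilon> \<theta> z"
  unfolding mixture_ratio_def by (rule abs_ln_mixture_le(1)) (use assms in auto)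

lemma normal_density_shift:
  "normal_density \<theta> 1 z = std_normal_density z * exp (\<theta> * z - \<theta>\<^sup>2 / 2)"
  unfolding normal_density_def
  by (simp add: exp_add[symmetric] power2_eq_square field_simps)

text \<open>The conditional law of the row sum depends on the latent vector only through
  \<open>A i\<close>, whose marginal is Bernoulli; averaging the two possible normal laws gives the
  mixture.\<close>

lemma distr_normalized_sum_array_law:
  assumes "i \<in> {1..K}" "t \<ge> 1" "0 \<le> \<epsilon>" "\<epsilon> \<le> 1"
  shows "(\<lambda>X. (\<Sum>s=1..t. X (i, s)) / sqrt t) \<in> borel_measurable (array_law K \<epsilon> \<delta>)" (is "?Z \<in> _")
    and "distr (array_law K \<epsilon> \<delta>) borel (\<lambda>X. (\<Sum>s=1..t. X (i, s)) / sqrt t)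
      = density lborel (\<lambda>z. std_normal_density z * mixture_ratio \<epsilon> (\<delta> * sqrt t) z)"
proof -
  let ?\<theta> = "\<delta> * sqrt t"
  have coord: "(\<lambda>X. X (i, s)) \<in> borel_measurable (array_space K)" if "s \<in> {1..t}" for s
    unfolding array_space_def
    by (rule measurable_component_singleton) (use assms that in \<open>auto simp: array_index_def\<close>)
  have Z_space: "?Z \<in> borel_measurable (array_space K)"
    by (rule borel_measurable_divide[OF borel_measurable_sum[OF coord] borel_measurable_const])
  then show Z: "?Z \<in> borel_measurable (array_law K \<epsilon> \<delta>)"
    using measurable_cong_sets[OF sets_array_law refl] by blast
  have comp: "map_pmf (\<lambda>A. A i) (latent_law K \<epsilon>) = bernoulli_pmf \<epsilon>"
    unfolding latent_law_def using assms(1) by (subst Pi_pmf_component) auto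
  show "distr (array_law K \<epsilon> \<delta>) borel ?Z
      = density lborel (\<lambda>z. std_normal_density z * mixture_ratio \<epsilon> ?\<theta> z)"
  proof (rule measure_eqI)
    fix B assume "B \<in> sets (distr (array_law K \<epsilon> \<delta>) borel ?Z)"
    then have B [measurable]: "B \<in> sets borel" by simp
    let ?c = "\<lambda>b. emeasure (density lborel (normal_density (?\<theta> * of_bool b) 1)) B"
    have not_empty: "space (measure_pmf (latent_law K \<epsilon>)) \<noteq> {}" by simp
    have "emeasure (distr (array_law K \<epsilon> \<delta>) borel ?Z) B
        = (\<integral>\<^sup>+A. emeasure (distr (conditional_law K \<delta> A) borel ?Z) B \<partial>latent_law K \<epsilon>)"
      unfolding array_law_def
      unfolding distr_bind[OF measurable_conditional_law not_empty Z_space]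
      by (rule emeasure_bind[OF not_empty measurable_compose[OF measurable_conditional_law measurable_distr[OF Z_space]] B])
    also have "\<dots> = (\<integral>\<^sup>+A. ?c (A i) \<partial>latent_law K \<epsilon>)"
    proof (rule nn_integral_cong)
      fix A
      have "distr (conditional_law K \<delta> A) borel ?Z = distr (conditional_law K \<delta> A) lborel ?Z"
        by (rule distr_cong) auto
      then show "emeasure (distr (conditional_law K \<delta> A) borel ?Z) B = ?c (A i)"
        using distributed_normalized_sum_conditional_law[OF assms(1,2), of \<delta> A]
        by (simp add: distributed_def)
    qed
    also have "\<dots> = (\<integral>\<^sup>+b. ?c b \<partial>bernoulli_pmf \<epsilon>)"
      unfolding comp[symmetric] by simp
    also have "\<dots> = ?c True * \<epsilon> + ?c False * (1 - \<epsilon>)"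
      using assms by simp
    also have "\<dots> = (\<integral>\<^sup>+z. ennreal (normal_density ?\<theta> 1 z) * indicator B z * ennreal \<epsilon> \<partial>lborel)
        + (\<integral>\<^sup>+z. ennreal (std_normal_density z) * indicator B z * ennreal (1 - \<epsilon>) \<partial>lborel)"
      by (subst (1 2) nn_integral_multc) (auto simp: emeasure_density)
    also have "\<dots> = (\<integral>\<^sup>+z. ennreal (normal_density ?\<theta> 1 z) * indicator B z * ennreal \<epsilon>
        + ennreal (std_normal_density z) * indicator B z * ennreal (1 - \<epsilon>) \<partial>lborel)"
      by (rule nn_integral_add[symmetric]) auto
    also have "\<dots> = (\<integral>\<^sup>+z. ennreal (std_normal_density z * mixture_ratio \<epsilon> ?\<theta> z) * indicator B z \<partial>lborel)"
    proof (rule nn_integral_cong)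
      fix z
      have "std_normal_density z * mixture_ratio \<epsilon> ?\<theta> z
          = normal_density ?\<theta> 1 z * \<epsilon> + std_normal_density z * (1 - \<epsilon>)"
        unfolding normal_density_shift[of ?\<theta> z] mixture_ratio_def by (simp only: algebra_simps)
      then show "ennreal (normal_density ?\<theta> 1 z) * indicator B z * ennreal \<epsilon>
          + ennreal (std_normal_density z) * indicator B z * ennreal (1 - \<epsilon>)
          = ennreal (std_normal_density z * mixture_ratio \<epsilon> ?\<theta> z) * indicator B z"
        using assms by (simp add: ennreal_mult indicator_def)
    qed
    also have "\<dots> = emeasure (density lborel (\<lambda>z. std_normal_density z * mixture_ratio \<epsilon> ?\<theta> z)) B"
      by (rule emeasure_density[symmetric]) auto
    finally show "emeasure (distr (array_law K \<epsilon> \<delta>) borel ?Z) B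
      = emeasure (density lborel (\<lambda>z. std_normal_density z * mixture_ratio \<epsilon> ?\<theta> z)) B" .
  qed simp
qed

subsection \<open>Entropy and the divergence of the mixture\<close>

text \<open>In the divergence the part \<open>- u + 1\<close> integrates to zero, since a density
  ratio has mean 1; it makes the integrand nonnegative, so lower bounds may restrict to an
  interval.\<close>

definition entropy_gap :: "real \<Rightarrow> real" where
  "entropy_gap u = u * ln u - u + 1"

lemma borel_measurable_entropy_gap [measurable]: "entropy_gap \<in> borel_measurable borel"
  unfolding entropy_gap_def by measurable

text \<open>Apply \<open>ln v \<le> v - 1\<close> at \<open>v = 1 / sqrt u\<close>. This is the
  pointwise form of bounding the Kullback-Leibler divergence below by the squared Hellinger
  distance.\<close>

lemma entropy_gap_ge_sqrt:
  assumes "u > 0"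
  shows "(sqrt u - 1)\<^sup>2 \<le> entropy_gap u"
proof -
  have "ln (1 / sqrt u) \<le> 1 / sqrt u - 1" using assms by (intro ln_le_minus_one) auto
  then have "2 - 2 / sqrt u \<le> ln u" using assms by (simp add: ln_div ln_sqrt)
  then have "u * (2 - 2 / sqrt u) \<le> u * ln u" using assms by (intro mult_left_mono) auto
  moreover have "s * s * (2 - 2 / s) = 2 * (s * s) - 2 * s" if "s > 0" for s :: real
    using that by (simp add: field_simps)
  from this[of "sqrt u"] have "u * (2 - 2 / sqrt u) = 2 * u - 2 * sqrt u"
    using assms by simp
  ultimately show ?thesis using assms by (simp add: entropy_gap_def power2_diff)
qed

lemma entropy_gap_nonneg: "u > 0 \<Longrightarrow> 0 \<le> entropy_gap u"
  by (rule order_trans[OF _ entropy_gap_ge_sqrt]) auto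

text \<open>For \<open>r = sqrt (1 + w)\<close>, \<open>w = (r - 1) * (r + 1)\<close> and
  \<open>(r + 1)^2 \<le> 2 * (r^2 + 1)\<close>. The bound is quadratic for small \<open>w\<close>
  and linear for large \<open>w\<close>.\<close>

lemma entropy_gap_ge_square:
  assumes "w \<ge> 0"
  shows "w\<^sup>2 / (4 + 2 * w) \<le> entropy_gap (1 + w)"
proof -
  let ?r = "sqrt (1 + w)"
  have r: "?r \<ge> 1" "?r\<^sup>2 = 1 + w" using assms by auto
  have "w\<^sup>2 = (?r - 1)\<^sup>2 * (?r + 1)\<^sup>2"
  proof -
    have "w = (?r - 1) * (?r + 1)" using r(2) by (simp add: algebra_simps power2_eq_square)
    then show ?thesis by (metis power_mult_distrib)
  qed
  also have "(?r + 1)\<^sup>2 \<le> 4 + 2 * w"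
    using r sum_squares_ge_zero[of "?r - 1" 0] by (simp add: power2_eq_square algebra_simps)
  then have "(?r - 1)\<^sup>2 * (?r + 1)\<^sup>2 \<le> (?r - 1)\<^sup>2 * (4 + 2 * w)"
    by (intro mult_left_mono) auto
  finally have "w\<^sup>2 / (4 + 2 * w) \<le> (?r - 1)\<^sup>2" using assms by (simp add: divide_le_eq)
  also have "\<dots> \<le> entropy_gap (1 + w)" using assms by (intro entropy_gap_ge_sqrt) auto
  finally show ?thesis .
qed

text \<open>The two sides differ by \<open>ln u\<close>. Unlike
  \<open>entropy_gap_ge_square\<close>, this keeps the logarithmic growth on which the case \<beta>
  = 1 rests.\<close>

lemma entropy_gap_ge_ln:
  assumes "u \<ge> 1"
  shows "(u - 1) * (ln u - 1) \<le> entropy_gap u"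
  using ln_ge_zero[OF assms] by (simp add: entropy_gap_def algebra_simps)

lemma entropy_gap_mono:
  assumes "1 \<le> u" "u \<le> v"
  shows "entropy_gap u \<le> entropy_gap v"
proof (rule DERIV_nonneg_imp_nondecreasing[OF assms(2)])
  fix x assume "u \<le> x" "x \<le> v"
  then have "(entropy_gap has_real_derivative ln x) (at x)" "0 \<le> ln x"
    unfolding entropy_gap_def using assms by (auto intro!: derivative_eq_intros)
  then show "\<exists>y. (entropy_gap has_real_derivative y) (at x) \<and> 0 \<le> y" by blast
qed

text \<open>Up to \<open>u = 2\<close> the gap is at most \<open>(u - 1)^2\<close>, and lowering the
  exponent of \<open>\<bar>u - 1\<bar> \<le> 1\<close> only increases it. Beyond 2,
  \<open>ln u \<le> u powr (p - 1) / (p - 1)\<close> and \<open>u \<le> 2 * (u - 1)\<close>.\<close>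

lemma entropy_gap_le_powr:
  assumes "u > 0" "1 < p" "p \<le> 2"
  shows "entropy_gap u \<le> 2 powr p / (p - 1) * \<bar>u - 1\<bar> powr p"
proof (cases "u \<le> 2")
  case True
  have "ln u \<le> u - 1" using assms(1) by (rule ln_le_minus_one)
  then have "u * ln u \<le> u * (u - 1)" using assms(1) by (intro mult_left_mono) auto
  then have "entropy_gap u \<le> \<bar>u - 1\<bar> powr 2"
    by (simp add: entropy_gap_def power2_eq_square algebra_simps)
  also have "\<dots> \<le> \<bar>u - 1\<bar> powr p" using assms True by (intro powr_mono') auto
  also have "\<dots> \<le> 2 powr p / (p - 1) * \<bar>u - 1\<bar> powr p"
  proof -
    have "1 \<le> 2 powr p" using assms by (intro ge_one_powr_ge_zero) auto
    then have "1 \<le> 2 powr p / (p - 1)" using assms by (simp add: le_divide_eq)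
    then show ?thesis by (metis mult_right_mono mult_1 powr_ge_zero)
  qed
  finally show ?thesis .
next
  case False
  have "entropy_gap u \<le> u * ln u" using False by (simp add: entropy_gap_def)
  also have "\<dots> \<le> u * (u powr (p - 1) / (p - 1))"
    using False assms by (intro mult_left_mono ln_powr_bound) auto
  also have "\<dots> = u powr p / (p - 1)" using assms by (simp add: powr_diff)
  also have "\<dots> \<le> (2 * (u - 1)) powr p / (p - 1)"
    using False assms by (intro divide_right_mono powr_mono2) auto
  also have "\<dots> = 2 powr p / (p - 1) * \<bar>u - 1\<bar> powr p"
    using False powr_mult[of 2 "u - 1" p] by simp
  finally show ?thesis .
qed

text \<open>The \<open>p\<close>-th power of the density ratio tilts the standard normal to mean
  \<open>p * \<theta>\<close>; the constant is the \<open>p\<close>-th moment of the ratio.\<close>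

lemma exp_tilt_powr:
  "std_normal_density z * exp (\<theta> * z - \<theta>\<^sup>2 / 2) powr p
     = exp (p * (p - 1) * \<theta>\<^sup>2 / 2) * normal_density (p * \<theta>) 1 z"
proof -
  have "exp (\<theta> * z - \<theta>\<^sup>2 / 2) powr p
      = exp (p * (p - 1) * \<theta>\<^sup>2 / 2) * exp ((p * \<theta>) * z - (p * \<theta>)\<^sup>2 / 2)"
    by (simp add: powr_def exp_add[symmetric] power2_eq_square field_simps)
  then show ?thesis unfolding normal_density_shift[of "p * \<theta>"] by simp
qed

section \<open>Upper bound for the divergence\<close>

definition mixture_divergence :: "real \<Rightarrow> real \<Rightarrow> real" where
  "mixture_divergence \<epsilon> \<theta> = (\<integral>z. std_normal_density z * entropy_gap (mixture_ratio \<epsilon> \<theta> z) \<partial>lborel)"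

text \<open>The deviation of the mixture ratio from 1 is \<open>\<epsilon> * (L - 1)\<close>, and
  \<open>\<bar>L - 1\<bar> powr p\<close> is at most \<open>2 powr p * (L powr p + 1)\<close>. The
  majorant combines normal densities, so its integral is explicit.\<close>

lemma entropy_gap_mixture_le:
  assumes "0 \<le> \<epsilon>" "\<epsilon> \<le> 1" "1 < p" "p \<le> 2"
  shows "std_normal_density z * entropy_gap (mixture_ratio \<epsilon> \<theta> z) \<le>
    4 powr p / (p - 1) * \<epsilon> powr p *
      (exp (p * (p - 1) * \<theta>\<^sup>2 / 2) * normal_density (p * \<theta>) 1 z + std_normal_density z)"
proof -
  define L where "L = exp (\<theta> * z - \<theta>\<^sup>2 / 2)"
  have L: "L > 0" by (simp add: L_def)
  have "\<bar>L - 1\<bar> powr p \<le> (2 * max L 1) powr p"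
    using L assms by (intro powr_mono2) (auto simp: max_def)
  also have "\<dots> = 2 powr p * max L 1 powr p" using L by (simp add: powr_mult)
  also have "\<dots> \<le> 2 powr p * (L powr p + 1)"
    by (intro mult_left_mono) (auto simp: max_def)
  finally have *: "\<bar>L - 1\<bar> powr p \<le> 2 powr p * (L powr p + 1)" .
  have "mixture_ratio \<epsilon> \<theta> z - 1 = \<epsilon> * (L - 1)"
    by (simp add: mixture_ratio_def L_def algebra_simps)
  then have "\<bar>mixture_ratio \<epsilon> \<theta> z - 1\<bar> powr p = \<epsilon> powr p * \<bar>L - 1\<bar> powr p"
    using assms by (simp add: abs_mult powr_mult)
  then have "entropy_gap (mixture_ratio \<epsilon> \<theta> z) \<le> 2 powr p / (p - 1) * (\<epsilon> powr p * \<bar>L - 1\<bar> powr p)"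
    using entropy_gap_le_powr[OF mixture_ratio_pos[OF assms(1,2)] assms(3,4), of \<theta> z] by simp
  also have "\<dots> \<le> 2 powr p / (p - 1) * (\<epsilon> powr p * (2 powr p * (L powr p + 1)))"
    using assms * by (intro mult_left_mono) auto
  also have "\<dots> = (2 powr p * 2 powr p) / (p - 1) * \<epsilon> powr p * (L powr p + 1)" by simp
  also have "2 powr p * 2 powr p = (4::real) powr p" by (simp add: powr_mult[symmetric])
  finally have "entropy_gap (mixture_ratio \<epsilon> \<theta> z) \<le> 4 powr p / (p - 1) * \<epsilon> powr p * (L powr p + 1)" .
  then have "std_normal_density z * entropy_gap (mixture_ratio \<epsilon> \<theta> z)
      \<le> std_normal_density z * (4 powr p / (p - 1) * \<epsilon> powr p * (L powr p + 1))"
    by (intro mult_left_mono) auto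
  also have "\<dots> = 4 powr p / (p - 1) * \<epsilon> powr p * (std_normal_density z * L powr p + std_normal_density z)"
    by (simp add: algebra_simps)
  finally show ?thesis unfolding L_def exp_tilt_powr .
qed

lemma integrable_entropy_gap_mixture:
  assumes "0 \<le> \<epsilon>" "\<epsilon> \<le> 1"
  shows "integrable lborel (\<lambda>z. std_normal_density z * entropy_gap (mixture_ratio \<epsilon> \<theta> z))"
proof (rule Bochner_Integration.integrable_bound)
  \<comment> \<open>The case \<open>p = 2\<close> of \<open>entropy_gap_mixture_le\<close> serves as
    majorant.\<close>
  show "integrable lborel (\<lambda>z. 4 powr 2 / (2 - 1) * \<epsilon> powr 2 *
      (exp (2 * (2 - 1) * \<theta>\<^sup>2 / 2) * normal_density (2 * \<theta>) 1 z + std_normal_density z))"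
    by (intro integrable_mult_right Bochner_Integration.integrable_add integrable_normal_density) auto
  show "AE z in lborel. norm (std_normal_density z * entropy_gap (mixture_ratio \<epsilon> \<theta> z)) \<le>
     norm (4 powr 2 / (2 - 1) * \<epsilon> powr 2 *
      (exp (2 * (2 - 1) * \<theta>\<^sup>2 / 2) * normal_density (2 * \<theta>) 1 z + std_normal_density z))"
  proof (rule AE_I2)
    fix z
    have "0 \<le> std_normal_density z * entropy_gap (mixture_ratio \<epsilon> \<theta> z)"
      using entropy_gap_nonneg[OF mixture_ratio_pos[OF assms]] by simp
    then show "norm (std_normal_density z * entropy_gap (mixture_ratio \<epsilon> \<theta> z)) \<le>
     norm (4 powr 2 / (2 - 1) * \<epsilon> powr 2 *
      (exp (2 * (2 - 1) * \<theta>\<^sup>2 / 2) * normal_density (2 * \<theta>) 1 z + std_normal_density z))"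
      using entropy_gap_mixture_le[OF assms, of 2 z \<theta>] by simp
  qed
qed measurable

lemma mixture_divergence_nonneg:
  assumes "0 \<le> \<epsilon>" "\<epsilon> \<le> 1"
  shows "0 \<le> mixture_divergence \<epsilon> \<theta>"
  unfolding mixture_divergence_def
  using entropy_gap_nonneg[OF mixture_ratio_pos[OF assms]] by (intro Bochner_Integration.integral_nonneg) auto

lemma mixture_divergence_le:
  assumes "0 \<le> \<epsilon>" "\<epsilon> \<le> 1" "1 < p" "p \<le> 2"
  shows "mixture_divergence \<epsilon> \<theta> \<le> 2 * 4 powr p / (p - 1) * \<epsilon> powr p * exp (p * (p - 1) * \<theta>\<^sup>2 / 2)"
proof -
  let ?C = "4 powr p / (p - 1) * \<epsilon> powr p" and ?e = "exp (p * (p - 1) * \<theta>\<^sup>2 / 2)"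
  have "mixture_divergence \<epsilon> \<theta> \<le>
     (\<integral>z. ?C * (?e * normal_density (p * \<theta>) 1 z + std_normal_density z) \<partial>lborel)"
    unfolding mixture_divergence_def
    using integrable_entropy_gap_mixture[OF assms(1,2)] entropy_gap_mixture_le[OF assms]
    by (intro integral_mono) auto
  also have "\<dots> = ?C * (?e + 1)" by simp
  \<comment> \<open>The exponent in \<open>?e\<close> is nonnegative, so
    \<open>1 \<le> ?e\<close>.\<close>
  also have "\<dots> \<le> ?C * (?e + ?e)"
    using assms by (intro mult_left_mono add_left_mono) auto
  finally show ?thesis by (simp add: algebra_simps)
qed

section \<open>Lower bounds for the divergence\<close>

lemma mixture_divergence_ge:
  assumes "0 \<le> \<epsilon>" "\<epsilon> \<le> 1"
    and m: "\<And>z. a \<le> z \<Longrightarrow> z \<le> a + 1 \<Longrightarrow> m \<le> std_normal_density z * entropy_gap (mixture_ratio \<epsilon> \<theta> z)"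
  shows "m \<le> mixture_divergence \<epsilon> \<theta>"
proof -
  have int: "integrable lborel (\<lambda>z. indicator {a..a + 1} z * m)"
    by (intro integrable_mult_left integrable_real_indicator) auto
  have "m = (\<integral>z. indicator {a..a + 1} z * m \<partial>lborel)" by simp
  also have "\<dots> \<le> mixture_divergence \<epsilon> \<theta>"
    unfolding mixture_divergence_def
    using int integrable_entropy_gap_mixture[OF assms(1,2), of \<theta>] m
      entropy_gap_nonneg[OF mixture_ratio_pos[OF assms(1,2)]]
    by (intro integral_mono) (auto simp: indicator_def)
  finally show ?thesis .
qed

lemma std_normal_density_antimono:
  assumes "0 \<le> y" "y \<le> z"
  shows "std_normal_density z \<le> std_normal_density y"
  using assms power_mono[of y z 2] by (simp add: std_normal_density_def divide_right_mono)

lemma mixture_ratio_mono: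
  assumes "0 \<le> \<epsilon>" "0 \<le> \<theta>" "y \<le> z"
  shows "mixture_ratio \<epsilon> \<theta> y \<le> mixture_ratio \<epsilon> \<theta> z"
  unfolding mixture_ratio_def using assms by (intro add_left_mono mult_left_mono) (auto intro: mult_left_mono)

text \<open>On the interval the normal density falls and the mixture ratio rises, so the two factors
  are bounded at opposite ends. From \<open>\<theta> / 2\<close> on, the density ratio is at least
  1, which puts the mixture ratio where \<open>entropy_gap\<close> increases.\<close>

lemma mixture_divergence_ge_point:
  assumes "0 \<le> \<epsilon>" "\<epsilon> \<le> 1" "0 \<le> \<theta>" "0 \<le> a" "\<theta> \<le> 2 * a"
  shows "std_normal_density (a + 1) * entropy_gap (mixture_ratio \<epsilon> \<theta> a) \<le> mixture_divergence \<epsilon> \<theta>"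
proof (rule mixture_divergence_ge[where a = a])
  fix z assume z: "a \<le> z" "z \<le> a + 1"
  have "\<theta> * \<theta> \<le> \<theta> * (2 * a)" using assms by (intro mult_left_mono) auto
  then have "1 \<le> exp (\<theta> * a - \<theta>\<^sup>2 / 2)" by (simp add: power2_eq_square)
  then have "\<epsilon> * 1 \<le> \<epsilon> * exp (\<theta> * a - \<theta>\<^sup>2 / 2)" using assms by (intro mult_left_mono) auto
  then have "1 \<le> mixture_ratio \<epsilon> \<theta> a" by (simp add: mixture_ratio_def)
  then show "std_normal_density (a + 1) * entropy_gap (mixture_ratio \<epsilon> \<theta> a)
      \<le> std_normal_density z * entropy_gap (mixture_ratio \<epsilon> \<theta> z)"
    using assms z mixture_ratio_pos[OF assms(1,2)]
    by (intro mult_mono std_normal_density_antimono entropy_gap_mono mixture_ratio_mono entropy_gap_nonneg) auto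
qed (use assms in auto)

section \<open>The expectation as a divergence\<close>

lemma normal_mixture_density:
  "integrable lborel (\<lambda>z. std_normal_density z * mixture_ratio \<epsilon> \<theta> z)"
  "(\<integral>z. std_normal_density z * mixture_ratio \<epsilon> \<theta> z \<partial>lborel) = 1"
proof -
  have eq: "(\<lambda>z. std_normal_density z * mixture_ratio \<epsilon> \<theta> z)
      = (\<lambda>z. (1 - \<epsilon>) * std_normal_density z + \<epsilon> * normal_density \<theta> 1 z)"
    unfolding mixture_ratio_def normal_density_shift[of \<theta>] by (simp add: algebra_simps fun_eq_iff)
  show "integrable lborel (\<lambda>z. std_normal_density z * mixture_ratio \<epsilon> \<theta> z)"
    unfolding eq
    by (intro integrable_mult_right Bochner_Integration.integrable_add integrable_normal_density) auto
  show "(\<integral>z. std_normal_density z * mixture_ratio \<epsilon> \<theta> z \<partial>lborel) = 1"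
    unfolding eq by simp
qed

lemma expectation_ln_likelihood_ratio:
  assumes "t \<ge> 1" "0 \<le> \<epsilon>" "\<epsilon> \<le> 1"
  shows "(LINT X|array_law K \<epsilon> \<delta>. ln (likelihood_ratio K \<epsilon> \<delta> t X))
    = real K * mixture_divergence \<epsilon> (\<delta> * sqrt t)"
proof -
  let ?\<theta> = "\<delta> * sqrt t"
  let ?f = "mixture_ratio \<epsilon> ?\<theta>"
  let ?Z = "\<lambda>i X. (\<Sum>s=1..t. X (i, s)) / sqrt t"
  have pos: "0 < ?f z" for z by (rule mixture_ratio_pos[OF assms(2,3)])
  have ratio: "joint_density t \<delta> (\<lambda>s. X (i, s)) / joint_density t 0 (\<lambda>s. X (i, s))
      = exp (?\<theta> * ?Z i X - ?\<theta>\<^sup>2 / 2)" for i and X :: "nat \<times> nat \<Rightarrow> real"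
  proof -
    have "ln (joint_density t \<delta> (\<lambda>s. X (i, s)) / joint_density t 0 (\<lambda>s. X (i, s)))
        = \<delta> * (\<Sum>s=1..t. X (i, s)) - t * (\<delta>\<^sup>2 / 2)"
      unfolding ln_density_ratio by (simp add: sum_subtractf sum_distrib_left)
    also have "\<dots> = ?\<theta> * ?Z i X - ?\<theta>\<^sup>2 / 2"
      using assms(1) by (simp add: power_mult_distrib)
    finally show ?thesis
      by (metis divide_pos_pos exp_ln joint_density_pos)
  qed
  have ln_eq: "ln (likelihood_ratio K \<epsilon> \<delta> t X) = (\<Sum>i=1..K. ln (?f (?Z i X)))" for X
    unfolding likelihood_ratio_def ratio mixture_ratio_def[symmetric]
    by (rule ln_prod) (use pos in \<open>auto simp: less_imp_neq[symmetric]\<close>)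
  \<comment> \<open>The difference of the two densities in the last bracket integrates to
    \<open>1 - 1 = 0\<close>.\<close>
  have split: "std_normal_density z * ?f z * ln (?f z)
      = std_normal_density z * entropy_gap (?f z) + (std_normal_density z * ?f z - std_normal_density z)" for z
    by (simp add: entropy_gap_def algebra_simps)
  have int: "integrable lborel (\<lambda>z. std_normal_density z * ?f z * ln (?f z))"
    unfolding split
    by (intro Bochner_Integration.integrable_add Bochner_Integration.integrable_diff
        integrable_entropy_gap_mixture normal_mixture_density integrable_normal_density assms) auto
  have val: "(\<integral>z. std_normal_density z * ?f z * ln (?f z) \<partial>lborel) = mixture_divergence \<epsilon> ?\<theta>"
    unfolding split mixture_divergence_def
    using integrable_entropy_gap_mixture[OF assms(2,3), of ?\<theta>] normal_mixture_density[of \<epsilon> ?\<theta>]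
    by (subst Bochner_Integration.integral_add) auto
  have ln_f: "(\<lambda>z. ln (?f z)) \<in> borel_measurable borel" by measurable
  have coord: "integrable (array_law K \<epsilon> \<delta>) (\<lambda>X. ln (?f (?Z i X)))
      \<and> (\<integral>X. ln (?f (?Z i X)) \<partial>array_law K \<epsilon> \<delta>) = mixture_divergence \<epsilon> ?\<theta>" if i: "i \<in> {1..K}" for i
  proof -
    note Z = distr_normalized_sum_array_law[OF i assms]
    have nn: "AE z in lborel. 0 \<le> std_normal_density z * ?f z"
      by (rule AE_I2) (simp add: less_imp_le[OF pos])
    have "integrable (distr (array_law K \<epsilon> \<delta>) borel (?Z i)) (\<lambda>z. ln (?f z))"
      unfolding Z(2) using int nn by (subst integrable_density) auto
    moreover have "(\<integral>z. ln (?f z) \<partial>distr (array_law K \<epsilon> \<delta>) borel (?Z i)) = mixture_divergence \<epsilon> ?\<theta>"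
      unfolding Z(2) val[symmetric] using nn by (subst integral_density) auto
    ultimately show ?thesis
      unfolding integrable_distr_eq[OF Z(1) ln_f] integral_distr[OF Z(1) ln_f] by blast
  qed
  then show ?thesis unfolding ln_eq by (subst Bochner_Integration.integral_sum) auto
qed

subsection \<open>Asymptotics of the divergence\<close>

text \<open>With \<open>x = sqrt (ln K)\<close>, \<open>exp (x^2)\<close> is \<open>K\<close>,
  \<open>exp (- \<beta> * x^2)\<close> is \<open>\<epsilon>\<close> and
  \<open>sqrt 2 * u * x\<close> is \<open>\<theta>\<close>; the moment bound then becomes a constant
  times \<open>exp (?k * x^2)\<close>.\<close>

lemma mixture_divergence_tendsto_0:
  assumes "0 < \<beta>" "1 < p" "p \<le> 2" and neg: "1 - p * \<beta> + p * (p - 1) * u\<^sup>2 < 0"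
  shows "((\<lambda>x. exp (x\<^sup>2) * mixture_divergence (exp (- \<beta> * x\<^sup>2)) (sqrt 2 * u * x)) \<longlongrightarrow> 0) at_top"
proof (rule real_tendsto_sandwich)
  let ?k = "1 - p * \<beta> + p * (p - 1) * u\<^sup>2"
  have \<epsilon>: "exp (- \<beta> * x\<^sup>2) \<le> 1" for x using assms by simp
  show "\<forall>\<^sub>F x in at_top. 0 \<le> exp (x\<^sup>2) * mixture_divergence (exp (- \<beta> * x\<^sup>2)) (sqrt 2 * u * x)"
    using mixture_divergence_nonneg[OF _ \<epsilon>] by simp
  show "\<forall>\<^sub>F x in at_top. exp (x\<^sup>2) * mixture_divergence (exp (- \<beta> * x\<^sup>2)) (sqrt 2 * u * x)
      \<le> 2 * 4 powr p / (p - 1) * exp (?k * x\<^sup>2)"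
  proof (intro always_eventually allI)
    fix x :: real
    have "exp (x\<^sup>2) * mixture_divergence (exp (- \<beta> * x\<^sup>2)) (sqrt 2 * u * x)
       \<le> exp (x\<^sup>2) * (2 * 4 powr p / (p - 1) * exp (- \<beta> * x\<^sup>2) powr p * exp (p * (p - 1) * (sqrt 2 * u * x)\<^sup>2 / 2))"
      using mixture_divergence_le[OF _ \<epsilon> assms(2,3)] by (intro mult_left_mono) auto
    also have "\<dots> = 2 * 4 powr p / (p - 1) * (exp (x\<^sup>2) * exp (p * (- \<beta> * x\<^sup>2)) * exp (p * (p - 1) * (u\<^sup>2 * x\<^sup>2)))"
      by (simp add: powr_def power_mult_distrib)
    also have "exp (x\<^sup>2) * exp (p * (- \<beta> * x\<^sup>2)) * exp (p * (p - 1) * (u\<^sup>2 * x\<^sup>2)) = exp (?k * x\<^sup>2)"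
      unfolding exp_add[symmetric] by (simp add: algebra_simps)
    finally show "exp (x\<^sup>2) * mixture_divergence (exp (- \<beta> * x\<^sup>2)) (sqrt 2 * u * x)
      \<le> 2 * 4 powr p / (p - 1) * exp (?k * x\<^sup>2)" .
  qed
  have "((\<lambda>x. exp (?k * x\<^sup>2)) \<longlongrightarrow> 0) at_top" using neg by real_asymp
  then show "((\<lambda>x. 2 * 4 powr p / (p - 1) * exp (?k * x\<^sup>2)) \<longlongrightarrow> 0) at_top"
    by (rule tendsto_mult_right_zero)
qed simp

text \<open>
  Here \<open>x = \<surd>(ln K)\<close>, and \<open>e\<close> is the exponent of \<open>K\<close> in \<open>\<epsilon>\<close> times the density ratio at \<open>z = \<surd>2 y x\<close>.
  The minimum reflects that the entropy is quadratic in this quantity when it is small and at least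
  linear when it is large.
\<close>

lemma mixture_divergence_at_top:
  fixes u y \<beta> :: real
  defines "e \<equiv> 2 * u * y - u\<^sup>2 - \<beta>"
  assumes "0 < \<beta>" "0 < u" "u < 2 * y" and pos: "0 < 1 - y\<^sup>2 + min e (2 * e)"
  shows "filterlim (\<lambda>x. exp (x\<^sup>2) * mixture_divergence (exp (- \<beta> * x\<^sup>2)) (sqrt 2 * u * x)) at_top at_top"
proof (rule filterlim_at_top_mono)
  define k where "k = 1 - y\<^sup>2 + min e (2 * e)"
  \<comment> \<open>The normal density contributes \<open>1 / sqrt (2 * pi)\<close>, the entropy
    bound \<open>1 / 20\<close>.\<close>
  define c where "c = 1 / (20 * sqrt (2 * pi))"
  have "k > 0" "c > 0" using pos by (auto simp: k_def c_def)
  then show "filterlim (\<lambda>x. c * exp (k * x\<^sup>2 - sqrt 2 * y * x - 1 / 2)) at_top at_top"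
    by real_asymp
  have "2 * u * y - u\<^sup>2 > 0" using assms(3,4) by (simp add: power2_eq_square)
  then have "filterlim (\<lambda>x. exp ((2 * u * y - u\<^sup>2) * x\<^sup>2)) at_top at_top" by real_asymp
  then have "\<forall>\<^sub>F x in at_top. 2 \<le> exp ((2 * u * y - u\<^sup>2) * x\<^sup>2)" unfolding filterlim_at_top by blast
  then show "\<forall>\<^sub>F x in at_top. c * exp (k * x\<^sup>2 - sqrt 2 * y * x - 1 / 2)
      \<le> exp (x\<^sup>2) * mixture_divergence (exp (- \<beta> * x\<^sup>2)) (sqrt 2 * u * x)"
    using eventually_ge_at_top[of 0]
  proof eventually_elim
    case (elim x)
    define \<epsilon> L W where "\<epsilon> = exp (- \<beta> * x\<^sup>2)" and "L = exp ((2 * u * y - u\<^sup>2) * x\<^sup>2)" and "W = exp (e * x\<^sup>2)"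
    have W: "W = \<epsilon> * L" unfolding \<epsilon>_def L_def W_def e_def exp_add[symmetric] by (simp add: algebra_simps)
    have \<epsilon>: "0 < \<epsilon>" "\<epsilon> \<le> 1" using assms by (auto simp: \<epsilon>_def)
    have "W > 0" by (simp add: W_def)
    \<comment> \<open>The right side is \<open>W^2 / (16 + 4 * W)\<close>; its denominator is at
      most 20 for \<open>W \<le> 1\<close> and at most \<open>20 * W\<close> for
      \<open>W \<ge> 1\<close>.\<close>
    have "min W (W\<^sup>2) / 20 \<le> (W / 2)\<^sup>2 / (4 + 2 * (W / 2))"
    proof (cases "W \<le> 1")
      case True
      then show ?thesis using \<open>W > 0\<close>
        by (simp add: min_def field_simps power2_eq_square)
    next
      case False
      then have "W * 1 \<le> W * W" by (intro mult_left_mono) auto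
      then show ?thesis using False by (simp add: min_def field_simps power2_eq_square)
    qed
    also have "\<dots> \<le> entropy_gap (1 + W / 2)" using \<open>W > 0\<close> by (intro entropy_gap_ge_square) auto
    also have "\<dots> \<le> entropy_gap (mixture_ratio \<epsilon> (sqrt 2 * u * x) (sqrt 2 * y * x))"
    proof (rule entropy_gap_mono)
      \<comment> \<open>Half of \<open>W\<close> absorbs the loss \<open>- \<epsilon>\<close> in the
        mixture ratio.\<close>
      have "\<epsilon> * 2 \<le> \<epsilon> * L" using elim \<epsilon> by (intro mult_left_mono) (auto simp: L_def)
      moreover have "sqrt 2 * u * x * (sqrt 2 * y * x) - (sqrt 2 * u * x)\<^sup>2 / 2 = (2 * u * y - u\<^sup>2) * x\<^sup>2"
        by (simp add: power_mult_distrib algebra_simps power2_eq_square)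
      ultimately show "1 + W / 2 \<le> mixture_ratio \<epsilon> (sqrt 2 * u * x) (sqrt 2 * y * x)"
        unfolding W mixture_ratio_def by (simp add: L_def)
    qed (use \<open>W > 0\<close> in auto)
    finally have ent: "min W (W\<^sup>2) / 20 \<le> entropy_gap (mixture_ratio \<epsilon> (sqrt 2 * u * x) (sqrt 2 * y * x))" .
    have minW: "min W (W\<^sup>2) = exp (min e (2 * e) * x\<^sup>2)"
      by (cases "e \<ge> 0") (auto simp: W_def min_def exp_double[symmetric] mult_ac mult_le_0_iff zero_le_mult_iff not_le)
    have "c * exp (k * x\<^sup>2 - sqrt 2 * y * x - 1 / 2)
        = exp (x\<^sup>2) * (std_normal_density (sqrt 2 * y * x + 1) * (min W (W\<^sup>2) / 20))"
    proof -
      \<comment> \<open>Evaluating the density one unit further right costs only terms of lower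
        order than \<open>x^2\<close>.\<close>
      have "k * x\<^sup>2 - sqrt 2 * y * x - 1 / 2 = x\<^sup>2 + (- (sqrt 2 * y * x + 1)\<^sup>2 / 2 + min e (2 * e) * x\<^sup>2)"
        unfolding k_def by (simp add: power2_sum power_mult_distrib field_simps)
      then show ?thesis unfolding minW c_def std_normal_density_def by (simp only: exp_add) simp
    qed
    also have "\<dots> \<le> exp (x\<^sup>2) * (std_normal_density (sqrt 2 * y * x + 1)
        * entropy_gap (mixture_ratio \<epsilon> (sqrt 2 * u * x) (sqrt 2 * y * x)))"
      using ent by (intro mult_left_mono) auto
    also have "\<dots> \<le> exp (x\<^sup>2) * mixture_divergence \<epsilon> (sqrt 2 * u * x)"
    proof -
      have "u * x \<le> 2 * y * x" using assms(4) elim by (intro mult_right_mono) auto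
      then have "sqrt 2 * (u * x) \<le> sqrt 2 * (2 * y * x)" by (intro mult_left_mono) auto
      then show ?thesis
        using \<epsilon> assms elim by (intro mult_left_mono mixture_divergence_ge_point) (auto simp: mult_ac)
    qed
    finally show ?case by (simp add: \<epsilon>_def)
  qed
qed

text \<open>Here \<open>exp (x^2) * \<epsilon> = 1\<close>, and the shifted normal has a fixed share
  of its mass on the unit interval from \<open>\<theta>\<close>, so the logarithm of the mixture
  ratio alone drives the growth.\<close>

lemma mixture_divergence_at_top_sparse:
  fixes u :: real
  assumes "1 < u"
  shows "filterlim (\<lambda>x. exp (x\<^sup>2) * mixture_divergence (exp (- 1 * x\<^sup>2)) (sqrt 2 * u * x)) at_top at_top"
proof (rule filterlim_at_top_mono)
  define c where "c = std_normal_density 1 / 2"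
  have "c > 0" by (simp add: c_def normal_density_pos)
  moreover have k: "u\<^sup>2 - 1 > 0" using assms by simp
  ultimately show "filterlim (\<lambda>x. c * ((u\<^sup>2 - 1) * x\<^sup>2 - ln 2 - 1)) at_top at_top"
    by real_asymp
  have "filterlim (\<lambda>x. (u\<^sup>2 - 1) * x\<^sup>2 - ln 2 - 1) at_top at_top" using k by real_asymp
  then have "\<forall>\<^sub>F x in at_top. 0 \<le> (u\<^sup>2 - 1) * x\<^sup>2 - ln 2 - 1" unfolding filterlim_at_top by blast
  then show "\<forall>\<^sub>F x in at_top. c * ((u\<^sup>2 - 1) * x\<^sup>2 - ln 2 - 1)
      \<le> exp (x\<^sup>2) * mixture_divergence (exp (- 1 * x\<^sup>2)) (sqrt 2 * u * x)"
    using eventually_ge_at_top[of 0]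
  proof eventually_elim
    case (elim x)
    \<comment> \<open>\<open>b\<close> will bound \<open>ln f - 1\<close> from below:
      \<open>ln 2\<close> pays for the factor 2 in \<open>big\<close>, and 1 for the subtraction in
      \<open>entropy_gap_ge_ln\<close>.\<close>
    define \<epsilon> \<theta> b where "\<epsilon> = exp (- 1 * x\<^sup>2)" and "\<theta> = sqrt 2 * u * x" and "b = (u\<^sup>2 - 1) * x\<^sup>2 - ln 2 - 1"
    have \<theta>: "\<theta> \<ge> 0" "\<theta>\<^sup>2 / 2 = u\<^sup>2 * x\<^sup>2" using assms elim by (auto simp: \<theta>_def power_mult_distrib)
    have \<epsilon>: "0 < \<epsilon>" "\<epsilon> \<le> 1" by (auto simp: \<epsilon>_def)
    have "\<epsilon> / 2 * std_normal_density 1 * b \<le> mixture_divergence \<epsilon> \<theta>"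
    proof (rule mixture_divergence_ge[where a = \<theta>])
      fix z assume z: "\<theta> \<le> z" "z \<le> \<theta> + 1"
      define L where "L = exp (\<theta> * z - \<theta>\<^sup>2 / 2)"
      have "\<theta> * \<theta> \<le> \<theta> * z" using z \<theta> by (intro mult_left_mono) auto
      then have "u\<^sup>2 * x\<^sup>2 \<le> \<theta> * z - \<theta>\<^sup>2 / 2" using \<theta>(2) by (simp add: power2_eq_square)
      then have "exp (- 1 * x\<^sup>2) * exp (u\<^sup>2 * x\<^sup>2) \<le> \<epsilon> * L" unfolding \<epsilon>_def L_def by simp
      then have "exp (b + 1 + ln 2) \<le> \<epsilon> * L" unfolding exp_add[symmetric] b_def by (simp add: algebra_simps)
      then have big: "2 * exp (b + 1) \<le> \<epsilon> * L" by (simp add: exp_add)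
      have "b \<ge> 0" using elim by (simp add: b_def)
      then have "1 \<le> exp (b + 1)" by simp
      then have "2 * \<epsilon> \<le> \<epsilon> * L" using big \<epsilon> by linarith
      then have f: "\<epsilon> * L / 2 \<le> mixture_ratio \<epsilon> \<theta> z - 1"
        by (simp add: mixture_ratio_def L_def)
      then have "exp (b + 1) \<le> mixture_ratio \<epsilon> \<theta> z" using big by linarith
      then have "ln (exp (b + 1)) \<le> ln (mixture_ratio \<epsilon> \<theta> z)"
        using mixture_ratio_pos[of \<epsilon> \<theta> z] \<epsilon> by (subst ln_le_cancel_iff) auto
      then have ln: "b \<le> ln (mixture_ratio \<epsilon> \<theta> z) - 1" by simp
      have ge_1: "1 \<le> mixture_ratio \<epsilon> \<theta> z"
        using \<open>1 \<le> exp (b + 1)\<close> \<open>exp (b + 1) \<le> mixture_ratio \<epsilon> \<theta> z\<close> by linarith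
      \<comment> \<open>The tilted density is the standard one recentred at \<open>\<theta>\<close>,
        at distance at most 1 from \<open>z\<close>.\<close>
      have "std_normal_density 1 \<le> std_normal_density (z - \<theta>)"
        using z by (intro std_normal_density_antimono) auto
      also have "\<dots> = std_normal_density z * L"
        unfolding L_def normal_density_shift[symmetric] by (simp add: normal_density_def)
      finally have "\<epsilon> / 2 * std_normal_density 1 * b \<le> \<epsilon> / 2 * (std_normal_density z * L) * b"
        using \<epsilon> \<open>b \<ge> 0\<close> by (intro mult_right_mono mult_left_mono) auto
      also have "\<dots> = std_normal_density z * (\<epsilon> * L / 2 * b)" by simp
      also have "\<dots> \<le> std_normal_density z * ((mixture_ratio \<epsilon> \<theta> z - 1) * (ln (mixture_ratio \<epsilon> \<theta> z) - 1))"
        using f ln ge_1 \<open>b \<ge> 0\<close> by (intro mult_left_mono mult_mono) auto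
      also have "\<dots> \<le> std_normal_density z * entropy_gap (mixture_ratio \<epsilon> \<theta> z)"
        using ge_1 by (intro mult_left_mono entropy_gap_ge_ln) auto
      finally show "\<epsilon> / 2 * std_normal_density 1 * b \<le> std_normal_density z * entropy_gap (mixture_ratio \<epsilon> \<theta> z)" .
    qed (use \<epsilon> in auto)
    then have "exp (x\<^sup>2) * (\<epsilon> / 2 * std_normal_density 1 * b) \<le> exp (x\<^sup>2) * mixture_divergence \<epsilon> \<theta>"
      by (intro mult_left_mono) auto
    moreover have "exp (x\<^sup>2) * \<epsilon> = 1" by (simp add: \<epsilon>_def exp_minus)
    then have "exp (x\<^sup>2) * (\<epsilon> / 2 * std_normal_density 1 * b) = c * b"
      by (simp add: c_def)
    ultimately have "c * b \<le> exp (x\<^sup>2) * mixture_divergence \<epsilon> \<theta>" by (simp only:)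
    then show ?case unfolding \<epsilon>_def \<theta>_def b_def .
  qed
qed

section \<open>Choice of the exponents\<close>

text \<open>The value \<open>1 / (1 - s)\<close> with \<open>s = sqrt (1 - \<beta>)\<close> is at
  most 2 only for \<open>\<beta> \<ge> 3 / 4\<close>; below that the cap \<open>p = 2\<close> is
  taken. At \<open>\<beta> = 1\<close> it degenerates to 1, so a \<open>p\<close> strictly between 1
  and \<open>1 / r\<close> replaces it.\<close>

lemma exponent_below_boundary:
  fixes r \<beta> :: real
  assumes "1 / 2 < \<beta>" "\<beta> \<le> 1" "r < detection_boundary \<beta>"
  obtains p where "1 < p" "p \<le> 2" "1 - p * \<beta> + p * (p - 1) * r < 0"
proof -
  consider "\<beta> < 3 / 4" | "3 / 4 \<le> \<beta>" "\<beta> < 1" | "\<beta> = 1" using assms by linarith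
  then show thesis
  proof cases
    case 1
    then show thesis using assms that[of 2] by (simp add: detection_boundary_def)
  next
    case 2
    define s where "s = sqrt (1 - \<beta>)"
    have s2: "s\<^sup>2 = 1 - \<beta>" using 2 by (simp add: s_def)
    have "sqrt (1 - \<beta>) \<le> sqrt ((1 / 2)\<^sup>2)" using 2 by (intro real_sqrt_le_mono) (simp add: power2_eq_square)
    then have s: "0 < s" "s \<le> 1 / 2" using 2 by (auto simp: s_def)
    have r: "r < (1 - s)\<^sup>2" using assms(3) 2 by (simp add: detection_boundary_def s_def)
    let ?p = "1 / (1 - s)"  \<comment> \<open>the minimizer of the exponent at \<open>r = (1 - s)\<^sup>2\<close>\<close>
    \<comment> \<open>Clearing denominators with \<open>q = 1 - s\<close>, where
      \<open>s / q = ?p - 1\<close>.\<close>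
    have "q\<^sup>2 * (1 - 1 / q * \<beta> + 1 / q * (s / q) * r) = q\<^sup>2 - q * \<beta> + s * r" if "q > 0" for q
      using that by (simp add: power2_eq_square field_simps)
    from this[of "1 - s"] have "(1 - s)\<^sup>2 * (1 - ?p * \<beta> + ?p * (?p - 1) * r) = (1 - s)\<^sup>2 - (1 - s) * \<beta> + s * r"
      using s by (simp add: diff_divide_distrib[symmetric] divide_diff_eq_iff)
    also have "\<dots> = s * (r - (1 - s)\<^sup>2)"
      using s2 by (simp add: power2_eq_square algebra_simps) algebra
    also have "\<dots> < 0" using s r by (simp add: mult_pos_neg)
    finally have "1 - ?p * \<beta> + ?p * (?p - 1) * r < 0"
      using s by (simp add: mult_less_0_iff)
    then show thesis using s by (intro that[of ?p]) (auto simp: field_simps)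
  next
    case 3
    then have r: "r < 1" using assms(3) by (simp add: detection_boundary_def)
    show thesis
    \<comment> \<open>The split keeps \<open>1 / r\<close> away from
      \<open>r \<le> 0\<close>.\<close>
    proof (cases "r \<le> 1 / 4")
      case True
      then show thesis using 3 by (intro that[of 2]) auto
    next
      case False
      let ?p = "min 2 ((1 + 1 / r) / 2)"
      have p: "1 < ?p" "?p * r < 1" using False r
        by (auto simp: min_def field_simps)
      have "1 - ?p * \<beta> + ?p * (?p - 1) * r = (?p - 1) * (?p * r - 1)" using 3 by (simp add: algebra_simps)
      also have "\<dots> < 0" using p by (simp add: mult_pos_neg)
      finally show thesis using p by (intro that[of ?p]) auto
    qed
  qed
qed

text \<open>Write \<open>e = 2 * u * y - u^2 - \<beta>\<close>. The branch with \<open>e\<close> is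
  \<open>s^2 - (y - u)^2\<close>, maximal at \<open>y = u\<close>; the branch with
  \<open>2 * e\<close> is maximal at \<open>y = 2 * u\<close>. Each maximizer is used if
  \<open>e\<close> has the right sign there, otherwise the crossing \<open>e = 0\<close>.\<close>

lemma exponent_above_boundary:
  fixes u \<beta> :: real
  assumes "1 / 2 < \<beta>" "\<beta> < 1" "detection_boundary \<beta> < u\<^sup>2" "0 < u"
  obtains y where "u < 2 * y"
    "0 < 1 - y\<^sup>2 + min (2 * u * y - u\<^sup>2 - \<beta>) (2 * (2 * u * y - u\<^sup>2 - \<beta>))"
proof -
  define s where "s = sqrt (1 - \<beta>)"
  have s2: "s\<^sup>2 = 1 - \<beta>" and s: "0 < s" using assms by (auto simp: s_def)
  show thesis
  proof (cases "1 - s < u")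
    case True
    show thesis
    proof (cases "\<beta> \<le> u\<^sup>2")
      case True
      have "u * u > 0" using assms by simp
      then show thesis using True assms by (intro that[of u]) (auto simp: power2_eq_square)
    next
      case False
      let ?y = "(u\<^sup>2 + \<beta>) / (2 * u)"  \<comment> \<open>the point at which \<open>\<epsilon>\<close> times the density ratio equals \<open>1\<close>\<close>
      have d: "?y - u = (\<beta> - u\<^sup>2) / (2 * u)" using assms by (simp add: field_simps power2_eq_square)
      have "1\<^sup>2 < (u + s)\<^sup>2" using True by (intro power_strict_mono) auto
      then have "\<beta> - u\<^sup>2 < s * (2 * u)" using s2 by (simp add: power2_eq_square algebra_simps)
      then have "?y - u < s" unfolding d using assms by (simp add: divide_less_eq)
      moreover have "0 \<le> ?y - u" unfolding d using False assms by simp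
      ultimately have "(?y - u)\<^sup>2 < s\<^sup>2" by (intro power_strict_mono) auto
      then have "?y\<^sup>2 - 2 * u * ?y + u\<^sup>2 < 1 - \<beta>" unfolding s2 power2_diff by (simp add: mult_ac)
      moreover have "2 * u * ?y - u\<^sup>2 - \<beta> = 0" using assms by simp
      moreover have "u < 2 * ?y" using \<open>0 \<le> ?y - u\<close> assms by linarith
      ultimately show thesis by (intro that[of ?y]) auto
    qed
  next
    case False
    \<comment> \<open>For \<open>\<beta> \<ge> 3 / 4\<close> the boundary is
      \<open>(1 - s)^2\<close>, so this case forces \<open>\<beta> < 3 / 4\<close>.\<close>
    then have le: "u\<^sup>2 \<le> (1 - s)\<^sup>2" using assms by (intro power_mono) auto
    have \<beta>: "\<beta> < 3 / 4" and r: "\<beta> - 1 / 2 < u\<^sup>2"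
      using assms(3) le by (auto simp: detection_boundary_def s_def split: if_splits)
    have "sqrt ((1 / 2)\<^sup>2) \<le> sqrt (1 - \<beta>)" using \<beta> by (intro real_sqrt_le_mono) (simp add: power2_eq_square)
    then have "1 / 2 \<le> s" by (simp add: s_def)
    then have "0 \<le> (1 - s) * (2 * (2 * s - 1))" using False assms by (intro mult_nonneg_nonneg) auto
    then have "3 * (1 - s)\<^sup>2 \<le> 1 - s\<^sup>2" by (simp add: power2_eq_square algebra_simps)
    \<comment> \<open>That is \<open>e \<le> 0\<close> at \<open>y = 2 * u\<close>, where the
      exponent is \<open>1 + 2 * u^2 - 2 * \<beta>\<close>.\<close>
    then have "3 * u\<^sup>2 \<le> \<beta>" using le s2 by linarith
    then show thesis using r assms by (intro that[of "2 * u"]) (auto simp: power2_eq_square min_def)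
  qed
qed

theorem theorem2p1:
  fixes t :: nat and \<beta> T :: real
  assumes "t \<ge> 1" and "1/2 < \<beta>" and "\<beta> \<le> 1" and "T > 0"
  defines "\<epsilon> \<equiv> \<lambda>K::nat. real K powr (- \<beta>)"
    and "\<delta> \<equiv> \<lambda>K::nat. sqrt (2 * (1 / T) * ln (real K))"
  shows "(real t < T * detection_boundary \<beta> \<longrightarrow>
            (\<lambda>K. LINT X|array_law K (\<epsilon> K) (\<delta> K). ln (likelihood_ratio K (\<epsilon> K) (\<delta> K) t X))
              \<longlonglongrightarrow> 0) \<and>
         (real t > T * detection_boundary \<beta> \<longrightarrow>
            filterlim (\<lambda>K. LINT X|array_law K (\<epsilon> K) (\<delta> K). ln (likelihood_ratio K (\<epsilon> K) (\<delta> K) t X))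
              at_top sequentially)"
proof -
  \<comment> \<open>Comparing \<open>t\<close> with the critical time becomes comparing
    \<open>u^2\<close> with the detection boundary.\<close>
  define u where "u = sqrt (t / T)"
  have u: "0 < u" "u\<^sup>2 = t / T" using assms(1,4) by (auto simp: u_def)
  define D where "D x = exp (x\<^sup>2) * mixture_divergence (exp (- \<beta> * x\<^sup>2)) (sqrt 2 * u * x)" for x :: real
  let ?E = "\<lambda>K. LINT X|array_law K (\<epsilon> K) (\<delta> K). ln (likelihood_ratio K (\<epsilon> K) (\<delta> K) t X)"
  have x: "filterlim (\<lambda>K. sqrt (ln (real K))) at_top sequentially" by real_asymp
  \<comment> \<open>\<open>K = 0\<close> is left out, where \<open>powr\<close> and
    \<open>ln\<close> take default values.\<close>
  have E: "\<forall>\<^sub>F K in sequentially. D (sqrt (ln (real K))) = ?E K"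
    using eventually_ge_at_top[of 1]
  proof eventually_elim
    case (elim K)
    have "exp (- \<beta> * ln (real K)) = \<epsilon> K" using elim by (simp add: \<epsilon>_def powr_def)
    moreover have "\<epsilon> K \<le> 1" using elim assms(2)
      by (simp add: \<epsilon>_def powr_minus inverse_le_1_iff ge_one_powr_ge_zero)
    moreover have "sqrt 2 * u * sqrt (ln (real K)) = \<delta> K * sqrt t"
      by (simp add: u_def \<delta>_def real_sqrt_mult real_sqrt_divide)
    ultimately show ?case
      using elim expectation_ln_likelihood_ratio[OF assms(1) powr_ge_zero, of "real K" "- \<beta>" K "\<delta> K"]
      unfolding D_def \<epsilon>_def by simp
  qed
  show ?thesis
  proof (intro conjI impI)
    assume "real t < T * detection_boundary \<beta>"
    then have "u\<^sup>2 < detection_boundary \<beta>" using assms(4) u by (simp add: divide_less_eq mult.commute)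
    then obtain p where "1 < p" "p \<le> 2" "1 - p * \<beta> + p * (p - 1) * u\<^sup>2 < 0"
      by (rule exponent_below_boundary[OF assms(2,3)])
    then have "(D \<longlongrightarrow> 0) at_top"
      unfolding D_def using assms(2) by (intro mixture_divergence_tendsto_0) auto
    from filterlim_compose[OF this x] show "?E \<longlonglongrightarrow> 0"
      by (rule Lim_transform_eventually[OF _ E])
  next
    assume "T * detection_boundary \<beta> < real t"
    then have b: "detection_boundary \<beta> < u\<^sup>2" using assms(4) u by (simp add: less_divide_eq mult.commute)
    \<comment> \<open>At \<open>\<beta> = 1\<close> the exponent is at most
      \<open>- (y - u)^2\<close> for every \<open>y\<close>, hence never positive.\<close>
    have "filterlim D at_top at_top"
    proof (cases "\<beta> = 1")
      case True
      then have "1\<^sup>2 < u\<^sup>2" using b by (simp add: detection_boundary_def)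
      then have "1 < u" using u(1) by (intro power2_less_imp_less[of 1 u]) auto
      then show ?thesis unfolding D_def True by (rule mixture_divergence_at_top_sparse)
    next
      case False
      then have "\<beta> < 1" using assms(3) by simp
      from assms(2) this b u(1) obtain y where "u < 2 * y"
        "0 < 1 - y\<^sup>2 + min (2 * u * y - u\<^sup>2 - \<beta>) (2 * (2 * u * y - u\<^sup>2 - \<beta>))"
        by (rule exponent_above_boundary)
      then show ?thesis
        unfolding D_def using assms(2) u(1) by (intro mixture_divergence_at_top) auto
    qed
    from filterlim_compose[OF this x] show "filterlim ?E at_top sequentially"
      unfolding filterlim_cong[OF refl refl E] .
  qed
qed

end
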